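(* Let $\hat{\mathbf v},\hat{\mathbf S},\hat\tau$ be constitutive mappings for velocity, stress and total energy, with $\hat{\mathbf v},\hat{\mathbf S}$ continuously differentiable and $\hat\tau$ continuously differentiable in $(\mathbf F,\mathbf p)$. Suppose that $\hat{\mathbf v}$ is normal (N), the associated $\tilde{\mathbf S}$ is elliptic (E), the solvability condition (S) holds for a given $T>0$, the dissipation inequality (D) is satisfied in all admissible smooth processes, $\hat{\mathbf v}$ satisfies the Galilean variance requirement (G), and $\hat\tau$ satisfies the parity requirement (P); all these conditions are spelled out in the context. Then there are a symmetric and invertible tensor $\mathbf V$, depending at most on $x$, with $\hat{\mathbf v}(x,\mathbf F,\mathbf p)=\mathbf V\mathbf p$, and a function $\hat\sigma$ of $\mathbf F$ (and possibly $x$), such that the total energy has the representation $$\hat\tau(\mathbf F,\mathbf p)=\hat\kappa(\mathbf p)+\hat\sigma(\mathbf F),\qquad \hat\kappa(\mathbf p)=\tfrac12\,\mathbf p\cdot\mathbf V\mathbf p,$$ for all $(\mathbf F,\mathbf p)\in\mathrm{Lin}\times\mathcal V$ (explicit dependence on $x$ left tacit), where $\hat\kappa$ is interpreted as the kinetic energy and $\hat\sigma$ as the stored energy.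
   Context: Vectors are elements of $\mathcal V=\mathbb R^3$ with the Euclidean inner product; tensors are linear maps of $\mathcal V$ into itself, forming the space $\mathrm{Lin}$, identified with $3\times3$ matrices in a fixed orthonormal basis, with inner product $\mathbf A\cdot\mathbf B=\sum_{i,j}A_{ij}B_{ij}$. $(\mathbf b\otimes\mathbf a)_{ij}=b_ia_j$, $(\nabla\mathbf v)_{ij}=\partial_{x_j}v_i$, $(\mathrm{Div}\,\mathbf S)_i=\sum_j\partial_{x_j}S_{ij}$ (the divergence of the field $x\mapsto\mathbf S(x,t)$); a superposed dot is $\partial_t$. The constitutive mappings are $\hat{\mathbf v}:\mathbb R^3\times\mathrm{Lin}\times\mathcal V\to\mathcal V$, $\hat{\mathbf S}:\mathbb R^3\times\mathrm{Lin}\times\mathcal V\to\mathrm{Lin}$ and $\hat\tau:\mathbb R^3\times\mathrm{Lin}\times\mathcal V\to\mathbb R$, functions of $(x,\mathbf F,\mathbf p)$ (possible explicit dependence on the point $x$, none on time). An admissible smooth process is a continuously differentiable pair $(\mathbf F,\mathbf p)$ on $\mathbb R^3\times[0,T)$, with values in $\mathrm{Lin}\times\mathcal V$, satisfying the conservation laws $\dot{\mathbf F}=\nabla\mathbf v$ and $\dot{\mathbf p}=\mathrm{Div}\,\mathbf S$ with $\mathbf v=\hat{\mathbf v}(x,\mathbf F,\mathbf p)$ and $\mathbf S=\hat{\mathbf S}(x,\mathbf F,\mathbf p)$. Time derivatives at $t=0$ are one-sided. (N) Normality: the matrix $N_{ih}=\partial_{p_h}\hat v_i(x,\mathbf F,\mathbf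 p)$ is invertible for all $(x,\mathbf F,\mathbf p)$; moreover for each $x,\mathbf F$ the map $\mathbf p\mapsto\hat{\mathbf v}(x,\mathbf F,\mathbf p)$ has an inverse $\mathbf v\mapsto\hat{\mathbf p}(x,\mathbf F,\mathbf v)$ defined on $\mathcal V$. Set $\tilde{\mathbf S}(x,\mathbf F,\mathbf v):=\hat{\mathbf S}(x,\mathbf F,\hat{\mathbf p}(x,\mathbf F,\mathbf v))$. (E) Ellipticity (in the sense of Petrovsky): for each vector $\mathbf a\ne\mathbf 0$ the matrix $E_{ih}(x,\mathbf F,\mathbf v;\mathbf a)=\sum_{j,k}\partial_{F_{hk}}\tilde S_{ij}(x,\mathbf F,\mathbf v)\,a_ja_k$ is invertible for all $(x,\mathbf F,\mathbf v)$. (S) Solvability: for all tensors $\mathbf A,\mathbf B$, vectors $\mathbf a\ne\mathbf 0,\mathbf b,\mathbf c$ and points $x_o\in\mathbb R^3$, the initial-value problem $$\dot{\mathbf F}=\nabla\mathbf v,\quad \dot{\mathbf p}=\mathrm{Div}\,\tilde{\mathbf S}(x,\mathbf F,\mathbf v),\quad \mathbf F(x,0)=\mathbf A+\big(\mathbf a\cdot(x-x_o)\big)\mathbf b\otimes\mathbf a,\quad \mathbf v(x,0)=\mathbf B(x-x_o)+\mathbf c,$$ with $\mathbf p=\hat{\mathbf p}(x,\mathbf F,\mathbf v)$, has a classical solution up to time $T$, i.e. a solution $(\mathbf F,\mathbf v)$ continuously differentiable on $\mathbb R^3\times[0,T)$. (D) Dissipation inequality: $\partial_t[\hat\tau(x,\mathbf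 F,\mathbf p)]\le\hat{\mathbf S}(x,\mathbf F,\mathbf p)\cdot\dot{\mathbf F}+\hat{\mathbf v}(x,\mathbf F,\mathbf p)\cdot\dot{\mathbf p}$ at all $(x,t)\in\mathbb R^3\times[0,T)$. (G) Galilean variance of velocity: for each $x$ there is a mapping $\hat{\mathbf c}_{\mathbf v}:\mathcal V\to\mathcal V$ (the same for all $(\mathbf F,\mathbf p)$) such that $\hat{\mathbf v}(x,\mathbf F,\mathbf p+\mathbf d)-\hat{\mathbf v}(x,\mathbf F,\mathbf p)=\hat{\mathbf c}_{\mathbf v}(\mathbf d)$ for all tensors $\mathbf F$ and all vectors $\mathbf p,\mathbf d$. (P) Parity of total energy with respect to momentum: $\hat\tau(x,\mathbf F,\mathbf p)=\hat\tau(x,\mathbf F,-\mathbf p)$ for all $(x,\mathbf F,\mathbf p)$. *)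

theory Defs
  imports "HOL-Analysis.Analysis"
begin

type_synonym vect = "real^3"
type_synonym tensor = "real^3^3"

text \<open>
  The inner product of \<^typ>\<open>tensor\<close> is the library's \<open>(\<bullet>)\<close> on \<^typ>\<open>real^3^3\<close>, which
  is the sum of the entrywise products. Constitutive mappings take the arguments
  \<open>x\<close>, \<open>F\<close>, \<open>p\<close> in curried form; time-dependent fields take \<open>x\<close>, \<open>t\<close>.
\<close>

definition continuously_differentiable_on ::
  "('a::real_normed_vector \<Rightarrow> 'b::real_normed_vector) \<Rightarrow> 'a set \<Rightarrow> bool" where
  "continuously_differentiable_on f S \<longleftrightarrow>
     (\<exists>f' :: 'a \<Rightarrow> 'a \<Rightarrow>\<^sub>L 'b.
        (\<forall>x\<in>S. (f has_derivative blinfun_apply (f' x)) (at x within S)) \<and>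
        continuous_on S f')"

text \<open>Since derivatives are taken within the set, those at \<open>t = 0\<close> are one-sided.\<close>

definition smooth_field ::
  "real \<Rightarrow> (vect \<Rightarrow> real \<Rightarrow> 'b::real_normed_vector) \<Rightarrow> bool" where
  "smooth_field T f \<longleftrightarrow>
     continuously_differentiable_on (\<lambda>(x, t). f x t) (UNIV \<times> {0..<T})"

definition dyad :: "vect \<Rightarrow> vect \<Rightarrow> tensor" where
  "dyad b a = (\<chi> i j. b $ i * a $ j)"

text \<open>
  Partial derivatives (and the library's \<^const>\<open>jacobian\<close>) are read off from the Frechet
  derivative, hence meaningful at points of differentiability only. All functions they are
  applied to below are differentiable for continuously differentiable constitutive mappings and
  fields; for functions of velocity this uses normality and the inverse function theorem.
\<close>

definition pd :: "('a::real_normed_vector \<Rightarrow> real) \<Rightarrow> 'a \<Rightarrow> 'a \<Rightarrow> real" where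
  "pd f e x = frechet_derivative f (at x) e"

definition Grad :: "(vect \<Rightarrow> vect) \<Rightarrow> vect \<Rightarrow> tensor" where
  "Grad v x = jacobian v (at x)"

definition Div :: "(vect \<Rightarrow> tensor) \<Rightarrow> vect \<Rightarrow> vect" where
  "Div S x = (\<chi> i. \<Sum>j\<in>UNIV. pd (\<lambda>y. S y $ i $ j) (axis j 1) x)"

definition time_deriv :: "real \<Rightarrow> (real \<Rightarrow> 'b::real_normed_vector) \<Rightarrow> real \<Rightarrow> 'b" where
  "time_deriv T f t = vector_derivative f (at t within {0..<T})"

definition admissible_process ::
  "(vect \<Rightarrow> tensor \<Rightarrow> vect \<Rightarrow> vect) \<Rightarrow> (vect \<Rightarrow> tensor \<Rightarrow> vect \<Rightarrow> tensor) \<Rightarrow> real \<Rightarrow>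
   (vect \<Rightarrow> real \<Rightarrow> tensor) \<Rightarrow> (vect \<Rightarrow> real \<Rightarrow> vect) \<Rightarrow> bool" where
  "admissible_process vh Sh T F p \<longleftrightarrow>
     smooth_field T F \<and> smooth_field T p \<and>
     (\<forall>x. \<forall>t\<in>{0..<T}.
        time_deriv T (F x) t = Grad (\<lambda>y. vh y (F y t) (p y t)) x \<and>
        time_deriv T (p x) t = Div (\<lambda>y. Sh y (F y t) (p y t)) x)"

definition normality :: "(vect \<Rightarrow> tensor \<Rightarrow> vect \<Rightarrow> vect) \<Rightarrow> bool" where
  "normality vh \<longleftrightarrow>
     (\<forall>x F p. invertible (jacobian (vh x F) (at p))) \<and>
     (\<forall>x F. bij (vh x F))"

definition momentum_of ::
  "(vect \<Rightarrow> tensor \<Rightarrow> vect \<Rightarrow> vect) \<Rightarrow> vect \<Rightarrow> tensor \<Rightarrow> vect \<Rightarrow> vect" where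
  "momentum_of vh x F = inv (vh x F)"

definition stress_of_velocity ::
  "(vect \<Rightarrow> tensor \<Rightarrow> vect \<Rightarrow> vect) \<Rightarrow> (vect \<Rightarrow> tensor \<Rightarrow> vect \<Rightarrow> tensor) \<Rightarrow>
   vect \<Rightarrow> tensor \<Rightarrow> vect \<Rightarrow> tensor" where
  "stress_of_velocity vh Sh x F w = Sh x F (momentum_of vh x F w)"

text \<open>
  The tensor \<open>axis h (axis k 1)\<close> has entry 1 at position \<open>(h, k)\<close> and 0 elsewhere,
  so the derivative below is the partial derivative with respect to \<open>F\<^bsub>hk\<^esub>\<close>.
\<close>

definition elliptic :: "(vect \<Rightarrow> tensor \<Rightarrow> vect \<Rightarrow> tensor) \<Rightarrow> bool" where
  "elliptic St \<longleftrightarrow>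
     (\<forall>a. a \<noteq> 0 \<longrightarrow> (\<forall>x F w.
        invertible ((\<chi> i h. \<Sum>j\<in>UNIV. \<Sum>k\<in>UNIV.
          pd (\<lambda>G. St x G w $ i $ j) (axis h (axis k 1)) F * a $ j * a $ k) :: tensor)))"

definition solvable ::
  "(vect \<Rightarrow> tensor \<Rightarrow> vect \<Rightarrow> vect) \<Rightarrow> (vect \<Rightarrow> tensor \<Rightarrow> vect \<Rightarrow> tensor) \<Rightarrow> real \<Rightarrow> bool" where
  "solvable vh Sh T \<longleftrightarrow>
     (\<forall>(A :: tensor) (B :: tensor) a b c xo. a \<noteq> 0 \<longrightarrow>
        (\<exists>(F :: vect \<Rightarrow> real \<Rightarrow> tensor) (v :: vect \<Rightarrow> real \<Rightarrow> vect).
           smooth_field T F \<and> smooth_field T v \<and>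
           (\<forall>x. \<forall>t\<in>{0..<T}.
              time_deriv T (F x) t = Grad (\<lambda>y. v y t) x \<and>
              time_deriv T (\<lambda>s. momentum_of vh x (F x s) (v x s)) t =
                Div (\<lambda>y. stress_of_velocity vh Sh y (F y t) (v y t)) x) \<and>
           (\<forall>x. F x 0 = A + (a \<bullet> (x - xo)) *\<^sub>R dyad b a \<and>
                v x 0 = B *v (x - xo) + c)))"

definition dissipation_inequality ::
  "(vect \<Rightarrow> tensor \<Rightarrow> vect \<Rightarrow> vect) \<Rightarrow> (vect \<Rightarrow> tensor \<Rightarrow> vect \<Rightarrow> tensor) \<Rightarrow>
   (vect \<Rightarrow> tensor \<Rightarrow> vect \<Rightarrow> real) \<Rightarrow> real \<Rightarrow>
   (vect \<Rightarrow> real \<Rightarrow> tensor) \<Rightarrow> (vect \<Rightarrow> real \<Rightarrow> vect) \<Rightarrow> bool" where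
  "dissipation_inequality vh Sh \<tau>h T F p \<longleftrightarrow>
     (\<forall>x. \<forall>t\<in>{0..<T}.
        time_deriv T (\<lambda>s. \<tau>h x (F x s) (p x s)) t
          \<le> Sh x (F x t) (p x t) \<bullet> time_deriv T (F x) t
            + vh x (F x t) (p x t) \<bullet> time_deriv T (p x) t)"

definition galilean_velocity :: "(vect \<Rightarrow> tensor \<Rightarrow> vect \<Rightarrow> vect) \<Rightarrow> bool" where
  "galilean_velocity vh \<longleftrightarrow>
     (\<forall>x. \<exists>cv :: vect \<Rightarrow> vect. \<forall>F p d. vh x F (p + d) - vh x F p = cv d)"

definition even_in_momentum :: "(vect \<Rightarrow> tensor \<Rightarrow> vect \<Rightarrow> real) \<Rightarrow> bool" where
  "even_in_momentum \<tau>h \<longleftrightarrow> (\<forall>x F p. \<tau>h x F p = \<tau>h x F (- p))"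

end

theory Submission
  imports Defs
begin

text \<open>
  At \<open>(x\<^sub>o, 0)\<close> the solution of the initial-value problem has \<open>\<nabla>v = B\<close> and
  \<open>Div S = E b + w(B)\<close> with the invertible matrix \<open>E\<close> of (E), so the rates of \<open>F\<close> and \<open>p\<close> can be
  prescribed independently there. The dissipation inequality then bounds one linear form in
  these rates by another, hence the two agree, and \<open>vh\<close> is the gradient of \<open>\<tau>h\<close> in \<open>p\<close>. Galilean
  variance makes \<open>vh\<close> affine in \<open>p\<close> with linear part \<open>V\<close> independent of \<open>F\<close>, parity makes its value
  at \<open>p = 0\<close> vanish, and integrating \<open>V p\<close> along rays gives the quadratic form; a linear gradient
  field is symmetric.
\<close>

subsection \<open>Continuously differentiable maps\<close>

lemma continuously_differentiable_onI:
  assumes "\<And>x. x \<in> S \<Longrightarrow> (f has_derivative blinfun_apply (f' x)) (at x within S)"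
    and "continuous_on S f'"
  shows "continuously_differentiable_on f S"
  using assms unfolding continuously_differentiable_on_def by blast

lemma continuously_differentiable_on_imp_continuous_on:
  "continuously_differentiable_on f S \<Longrightarrow> continuous_on S f"
  by (meson continuously_differentiable_on_def has_derivative_continuous_on)

lemma continuously_differentiable_on_bounded_linear:
  assumes "bounded_linear f"
  shows "continuously_differentiable_on f S"
  by (rule continuously_differentiable_onI[where f' = "\<lambda>_. Blinfun f"])
     (simp_all add: bounded_linear_Blinfun_apply assms bounded_linear_imp_has_derivative)

lemma continuously_differentiable_on_const:
  "continuously_differentiable_on (\<lambda>_. c) S"
  by (rule continuously_differentiable_onI[where f' = "\<lambda>_. 0"]) (auto simp: zero_blinfun.rep_eq)

lemma continuously_differentiable_on_add:
  assumes "continuously_differentiable_on f S" "continuously_differentiable_on g S"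
  shows "continuously_differentiable_on (\<lambda>x. f x + g x) S"
proof -
  obtain f' where f: "\<And>x. x \<in> S \<Longrightarrow> (f has_derivative blinfun_apply (f' x)) (at x within S)"
    "continuous_on S f'" using assms(1) unfolding continuously_differentiable_on_def by blast
  obtain g' where g: "\<And>x. x \<in> S \<Longrightarrow> (g has_derivative blinfun_apply (g' x)) (at x within S)"
    "continuous_on S g'" using assms(2) unfolding continuously_differentiable_on_def by blast
  show ?thesis
  proof (rule continuously_differentiable_onI[where f' = "\<lambda>x. f' x + g' x"])
    show "((\<lambda>x. f x + g x) has_derivative blinfun_apply (f' x + g' x)) (at x within S)"
      if "x \<in> S" for x
      using has_derivative_add[OF f(1)[OF that] g(1)[OF that]] by (simp add: plus_blinfun.rep_eq)
  qed (intro continuous_intros f g)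
qed

lemma continuously_differentiable_on_compose:
  assumes "continuously_differentiable_on f UNIV" "continuously_differentiable_on g S"
  shows "continuously_differentiable_on (\<lambda>x. f (g x)) S"
proof -
  obtain f' where f: "\<And>x. (f has_derivative blinfun_apply (f' x)) (at x)"
    "continuous_on UNIV f'" using assms(1) by (auto simp: continuously_differentiable_on_def)
  obtain g' where g: "\<And>x. x \<in> S \<Longrightarrow> (g has_derivative blinfun_apply (g' x)) (at x within S)"
    "continuous_on S g'" using assms(2) unfolding continuously_differentiable_on_def by blast
  have "continuous_on S (\<lambda>x. f' (g x))"
    using continuous_on_compose2[OF f(2) continuously_differentiable_on_imp_continuous_on[OF assms(2)]]
    by simp
  show ?thesis
  proof (rule continuously_differentiable_onI[where f' = "\<lambda>x. f' (g x) o\<^sub>L g' x"])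
    show "((\<lambda>x. f (g x)) has_derivative blinfun_apply (f' (g x) o\<^sub>L g' x)) (at x within S)"
      if "x \<in> S" for x
      using has_derivative_compose[OF g(1)[OF that] f(1)] by (simp add: blinfun_compose.rep_eq o_def)
  qed (intro continuous_intros g, fact)
qed

lemmas continuously_differentiable_on_linear_compose =
  continuously_differentiable_on_compose[OF continuously_differentiable_on_bounded_linear]

lemma continuously_differentiable_on_diff:
  assumes "continuously_differentiable_on f S" "continuously_differentiable_on g S"
  shows "continuously_differentiable_on (\<lambda>x. f x - g x) S"
  using continuously_differentiable_on_add[OF assms(1)
      continuously_differentiable_on_linear_compose[OF bounded_linear_minus[OF bounded_linear_ident] assms(2)]]
  by simp

lemma continuously_differentiable_on_sum:
  assumes "\<And>i. i \<in> I \<Longrightarrow> continuously_differentiable_on (f i) S"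
  shows "continuously_differentiable_on (\<lambda>x. \<Sum>i\<in>I. f i x) S"
  using assms by (induction I rule: infinite_finite_induct)
    (auto intro: continuously_differentiable_on_const continuously_differentiable_on_add)

lemma continuously_differentiable_on_Pair:
  assumes "continuously_differentiable_on f S" "continuously_differentiable_on g S"
  shows "continuously_differentiable_on (\<lambda>x. (f x, g x)) S"
proof -
  \<comment> \<open>Each component is embedded linearly into the product, so the pair is a sum of
    two linear images.\<close>
  have "continuously_differentiable_on (\<lambda>x. (f x, 0) + (0, g x)) S"
    by (intro continuously_differentiable_on_add
        continuously_differentiable_on_linear_compose[OF _ assms(1)]
        continuously_differentiable_on_linear_compose[OF _ assms(2)])
       (intro bounded_linear_intros)+
  then show ?thesis by simp
qed

lemma continuously_differentiable_on_mult:
  fixes f g :: "'a::real_normed_vector \<Rightarrow> real"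
  assumes "continuously_differentiable_on f S" "continuously_differentiable_on g S"
  shows "continuously_differentiable_on (\<lambda>x. f x * g x) S"
proof -
  obtain f' where f: "\<And>x. x \<in> S \<Longrightarrow> (f has_derivative blinfun_apply (f' x)) (at x within S)"
    "continuous_on S f'" using assms(1) unfolding continuously_differentiable_on_def by blast
  obtain g' where g: "\<And>x. x \<in> S \<Longrightarrow> (g has_derivative blinfun_apply (g' x)) (at x within S)"
    "continuous_on S g'" using assms(2) unfolding continuously_differentiable_on_def by blast
  show ?thesis
  proof (rule continuously_differentiable_onI[where f' = "\<lambda>x. f x *\<^sub>R g' x + g x *\<^sub>R f' x"])
    show "((\<lambda>x. f x * g x) has_derivative blinfun_apply (f x *\<^sub>R g' x + g x *\<^sub>R f' x)) (at x within S)"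
      if "x \<in> S" for x
      using has_derivative_mult[OF f(1)[OF that] g(1)[OF that]]
      by (simp add: plus_blinfun.rep_eq scaleR_blinfun.rep_eq mult.commute)
  qed (intro continuous_intros f g assms[THEN continuously_differentiable_on_imp_continuous_on])
qed

lemma continuously_differentiable_on_inverse:
  fixes f :: "'a::real_normed_vector \<Rightarrow> real"
  assumes "continuously_differentiable_on f S" "\<And>x. x \<in> S \<Longrightarrow> f x \<noteq> 0"
  shows "continuously_differentiable_on (\<lambda>x. inverse (f x)) S"
proof -
  obtain f' where f: "\<And>x. x \<in> S \<Longrightarrow> (f has_derivative blinfun_apply (f' x)) (at x within S)"
    "continuous_on S f'" using assms(1) unfolding continuously_differentiable_on_def by blast
  show ?thesis
  proof (rule continuously_differentiable_onI
      [where f' = "\<lambda>x. (- (inverse (f x) * inverse (f x))) *\<^sub>R f' x"])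
    show "((\<lambda>x. inverse (f x)) has_derivative
        blinfun_apply ((- (inverse (f x) * inverse (f x))) *\<^sub>R f' x)) (at x within S)"
      if "x \<in> S" for x
      using Deriv.has_derivative_inverse[OF assms(2)[OF that] f(1)[OF that]]
      by (simp add: scaleR_blinfun.rep_eq uminus_blinfun.rep_eq ac_simps)
  qed (intro continuous_intros f assms(1)[THEN continuously_differentiable_on_imp_continuous_on]
      ballI assms(2))
qed

lemma continuously_differentiable_on_divide:
  fixes f g :: "'a::real_normed_vector \<Rightarrow> real"
  assumes "continuously_differentiable_on f S" "continuously_differentiable_on g S"
    "\<And>x. x \<in> S \<Longrightarrow> g x \<noteq> 0"
  shows "continuously_differentiable_on (\<lambda>x. f x / g x) S"
  unfolding divide_inverse
  by (intro continuously_differentiable_on_mult continuously_differentiable_on_inverse assms)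

lemma continuously_differentiable_on_vec_nth:
  assumes "continuously_differentiable_on f S"
  shows "continuously_differentiable_on (\<lambda>x. f x $ i) S"
  by (rule continuously_differentiable_on_linear_compose[OF bounded_linear_vec_nth assms])

lemma continuously_differentiable_on_vec_lambda:
  fixes f :: "'a::real_normed_vector \<Rightarrow> 'n::finite \<Rightarrow> real"
  assumes "\<And>i. continuously_differentiable_on (\<lambda>x. f x i) S"
  shows "continuously_differentiable_on (\<lambda>x. \<chi> i. f x i) S"
proof -
  have "continuously_differentiable_on (\<lambda>x. \<Sum>i\<in>UNIV. f x i *\<^sub>R axis i (1::real)) S"
    by (intro continuously_differentiable_on_sum
        continuously_differentiable_on_linear_compose[OF _ assms] bounded_linear_intros)
  moreover have "(\<Sum>i\<in>UNIV. f x i *\<^sub>R axis i (1::real)) = (\<chi> i. f x i)" for x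
    by (simp add: vec_eq_iff axis_def if_distrib cong: if_cong)
  ultimately show ?thesis by simp
qed

text \<open>The expanded determinant is a polynomial in the entries.\<close>

lemma continuously_differentiable_on_det_3:
  fixes A :: "'a::real_normed_vector \<Rightarrow> real^3^3"
  assumes "\<And>i j. continuously_differentiable_on (\<lambda>x. A x $ i $ j) S"
  shows "continuously_differentiable_on (\<lambda>x. det (A x)) S"
  unfolding det_3
  by (intro continuously_differentiable_on_add continuously_differentiable_on_diff
      continuously_differentiable_on_mult assms)

section \<open>Jacobians, partial derivatives and ordered linear forms\<close>

lemma jacobian_mult_vec:
  fixes f :: "real^'n \<Rightarrow> real^'m"
  assumes "(f has_derivative f') (at x)"
  shows "jacobian f (at x) *v h = f' h"
  unfolding jacobian_def frechet_derivative_at[OF assms, symmetric]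
  using has_derivative_linear[OF assms]
  by (simp add: linear_matrix_vector_mul_eq matrix_works)

lemma pd_eq:
  assumes "(f has_derivative f') (at x)"
  shows "pd f e x = f' e"
  unfolding pd_def frechet_derivative_at[OF assms, symmetric] ..

lemma has_derivative_affine:
  fixes B :: "real^'n^'m"
  shows "((\<lambda>y. B *v (y - x) + c) has_derivative (*v) B) (at x)"
proof -
  have "((\<lambda>y. y - x) has_derivative (\<lambda>h. h)) (at x)"
    by (auto intro!: derivative_eq_intros)
  from has_derivative_add_const[OF bounded_linear.has_derivative[OF matrix_vector_mul_bounded_linear this]]
  show ?thesis .
qed

text \<open>Evaluating the inequality at \<open>- x\<close> reverses it. This is what turns the
  dissipation inequality into an identity.\<close>

lemma linear_le_imp_eq:
  fixes f g :: "'a::real_vector \<Rightarrow> real"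
  assumes "linear f" "linear g" "\<And>x. f x \<le> g x"
  shows "f x = g x"
  using assms(3)[of x] assms(3)[of "- x"] by (simp add: assms(1,2) linear_neg)

subsection \<open>Galilean velocity\<close>

text \<open>The increment map \<open>cv\<close> has the same derivative \<open>L\<close> at every
  point, so \<open>cv - L\<close> is constant, and it vanishes at 0. As \<open>cv\<close> is common
  to all \<open>F\<close>, the linear part can be read off at \<open>F = 0\<close>.\<close>

lemma galilean_velocity_affine:
  assumes "galilean_velocity vh"
    and "continuously_differentiable_on (\<lambda>(x, F, p). vh x F p) UNIV"
  shows "vh x F p = jacobian (vh x 0) (at 0) *v p + vh x F 0"
proof -
  obtain cv where cv: "\<And>F p d. vh x F (p + d) - vh x F p = cv d"
    using assms(1) unfolding galilean_velocity_def by blast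
  have "continuously_differentiable_on (vh x 0) UNIV"
    using continuously_differentiable_on_compose[OF assms(2)
      continuously_differentiable_on_Pair[OF continuously_differentiable_on_const
        continuously_differentiable_on_Pair[OF continuously_differentiable_on_const
          continuously_differentiable_on_bounded_linear[OF bounded_linear_ident]]]]
    by simp
  then obtain L where L: "(vh x 0 has_derivative L) (at 0)"
    unfolding continuously_differentiable_on_def by blast
  have "bounded_linear L" using L has_derivative_bounded_linear by blast
  have der: "(cv has_derivative L) (at p within UNIV)" for p
  proof -
    \<comment> \<open>Shifting the momentum by \<open>p\<close> changes \<open>vh x 0\<close> by a
      constant, so \<open>cv\<close> near \<open>p\<close> is a copy of \<open>vh x 0\<close> near 0
      up to a constant and inherits its derivative there.\<close>
    have "cv q = vh x 0 (q - p) + (vh x 0 p - vh x 0 0 - vh x 0 0)" for q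
    proof -
      have "cv q = vh x 0 (0 + q) - vh x 0 0" using cv[of 0 0 q] by simp
      moreover have "vh x 0 q - vh x 0 (q - p) = vh x 0 p - vh x 0 0"
        using cv[of 0 "q - p" p] cv[of 0 0 p] by simp
      ultimately show ?thesis by (simp add: diff_eq_eq)
    qed
    then have eq: "cv = (\<lambda>q. vh x 0 (q - p) + (vh x 0 p - vh x 0 0 - vh x 0 0))" by blast
    have "((\<lambda>q. vh x 0 (q - p)) has_derivative L) (at p)"
      by (rule has_derivative_compose[where g = "vh x 0" and f = "\<lambda>q. q - p" and f' = "\<lambda>h. h", simplified])
         (auto intro!: derivative_eq_intros L)
    then show ?thesis unfolding eq by (auto intro!: derivative_eq_intros)
  qed
  have "((\<lambda>q. cv q - L q) has_derivative (\<lambda>_. 0)) (at q within UNIV)" for q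
    using has_derivative_diff[OF der bounded_linear_imp_has_derivative[OF \<open>bounded_linear L\<close>]] by simp
  then obtain k where k: "\<And>q. cv q - L q = k"
    using has_derivative_zero_constant[OF convex_UNIV, of "\<lambda>q. cv q - L q"] by auto
  have "k = 0"
    using k[of 0] cv[of 0 0 0] linear_0[OF bounded_linear.linear[OF \<open>bounded_linear L\<close>]] by simp
  then have "cv p = L p" using k[of p] by simp
  then show ?thesis using cv[of F 0 p] jacobian_mult_vec[OF L] by (simp add: algebra_simps)
qed

text \<open>Galilean variance replaces the inverse function theorem: the velocity is affine in the
  momentum, so Cramer's rule exhibits the inverse as a rational expression.\<close>

lemma momentum_of_continuously_differentiable:
  assumes "continuously_differentiable_on (\<lambda>(x, F, p). vh x F p) UNIV"
    and "normality vh" "galilean_velocity vh"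
  shows "continuously_differentiable_on (\<lambda>(x, F, w). momentum_of vh x F w) UNIV"
proof -
  define V where "V x = jacobian (vh x 0) (at 0)" for x
  have vh_comp: "continuously_differentiable_on (\<lambda>z. vh (f z) (g z) (h z)) S"
    if "continuously_differentiable_on f S" "continuously_differentiable_on g S"
      "continuously_differentiable_on h S"
    for f g h and S :: "(vect \<times> tensor \<times> vect) set"
    using continuously_differentiable_on_compose[OF assms(1)
        continuously_differentiable_on_Pair[OF that(1) continuously_differentiable_on_Pair[OF that(2,3)]]]
    by simp
  have affine: "vh x F p = V x *v p + vh x F 0" for x F p
    unfolding V_def by (rule galilean_velocity_affine[OF assms(3,1)])
  have det: "det (V x) \<noteq> 0" for x
    using assms(2) unfolding normality_def V_def invertible_det_nz by blast
  \<comment> \<open>\<open>V\<close> is defined by a derivative of \<open>vh\<close>, which is only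
    known to be continuous. As a difference of values of \<open>vh\<close>, each entry is seen to be
    continuously differentiable in \<open>x\<close>.\<close>
  have entry: "V x $ i $ j = vh x 0 (axis j 1) $ i - vh x 0 0 $ i" for x i j
    using affine[of x 0 "axis j 1"] by (simp add: matrix_vector_mul_component column_def
        matrix_vector_mult_basis algebra_simps)
  have momentum: "momentum_of vh x F w =
      (\<chi> k. det (\<chi> i j. if j = k then (w - vh x F 0) $ i else V x $ i $ j) / det (V x))" for x F w
  proof -
    have "vh x F (momentum_of vh x F w) = w"
      using assms(2) unfolding normality_def momentum_of_def by (meson bij_is_surj surj_f_inv_f)
    then have "V x *v momentum_of vh x F w = w - vh x F 0"
      using affine[of x F "momentum_of vh x F w"] by (simp add: algebra_simps)
    then show ?thesis using cramer[OF det] by blast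
  qed
  have proj: "continuously_differentiable_on (\<lambda>z :: vect \<times> tensor \<times> vect. fst z) UNIV"
    "continuously_differentiable_on (\<lambda>z :: vect \<times> tensor \<times> vect. fst (snd z)) UNIV"
    "continuously_differentiable_on (\<lambda>z :: vect \<times> tensor \<times> vect. snd (snd z)) UNIV"
    by (intro continuously_differentiable_on_bounded_linear bounded_linear_intros)+
  have V: "continuously_differentiable_on (\<lambda>z :: vect \<times> tensor \<times> vect. V (fst z) $ i $ j) UNIV" for i j
    unfolding entry
    by (intro continuously_differentiable_on_diff continuously_differentiable_on_vec_nth vh_comp proj
        continuously_differentiable_on_const)
  have w: "continuously_differentiable_on
      (\<lambda>z :: vect \<times> tensor \<times> vect. (snd (snd z) - vh (fst z) (fst (snd z)) 0) $ i) UNIV" for i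
    by (intro continuously_differentiable_on_diff continuously_differentiable_on_vec_nth vh_comp proj
        continuously_differentiable_on_const)
  have numerator: "continuously_differentiable_on (\<lambda>z :: vect \<times> tensor \<times> vect.
      det (\<chi> i j. if j = k then (snd (snd z) - vh (fst z) (fst (snd z)) 0) $ i
                    else V (fst z) $ i $ j)) UNIV" for k
  proof (rule continuously_differentiable_on_det_3)
    show "continuously_differentiable_on (\<lambda>z :: vect \<times> tensor \<times> vect.
        (\<chi> i j. if j = k then (snd (snd z) - vh (fst z) (fst (snd z)) 0) $ i
                 else V (fst z) $ i $ j) $ i $ j) UNIV" for i j
      unfolding vec_lambda_beta using V[of i j] w[of i] by (cases "j = k") (simp_all only: refl if_True if_False)
  qed
  have "continuously_differentiable_on (\<lambda>z :: vect \<times> tensor \<times> vect. det (V (fst z))) UNIV"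
    by (rule continuously_differentiable_on_det_3) (rule V)
  with numerator show ?thesis
    unfolding momentum case_prod_unfold
    by (intro continuously_differentiable_on_vec_lambda continuously_differentiable_on_divide det)
qed

subsection \<open>Initial rates\<close>

abbreviation acoustic ::
  "(vect \<Rightarrow> tensor \<Rightarrow> vect \<Rightarrow> tensor) \<Rightarrow> vect \<Rightarrow> tensor \<Rightarrow> vect \<Rightarrow> vect \<Rightarrow> tensor" where
  "acoustic St x F w a \<equiv> (\<chi> i h. \<Sum>j\<in>UNIV. \<Sum>k\<in>UNIV.
     pd (\<lambda>G. St x G w $ i $ j) (axis h (axis k 1)) F * a $ j * a $ k)"

text \<open>The gradient of the initial deformation is \<open>b \<otimes> a \<otimes> a\<close>, which is contracted with the
  derivative of the stress in \<open>F\<close> to the acoustic matrix acting on \<open>b\<close>.\<close>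

lemma Div_initial_stress:
  assumes L: "((\<lambda>(x, F, w). St x F w) has_derivative L) (at (xo, A, c))"
  shows "Div (\<lambda>y. St y (A + (a \<bullet> (y - xo)) *\<^sub>R dyad b a) (B *v (y - xo) + c)) xo =
    acoustic St xo A c a *v b + (\<chi> i. \<Sum>j\<in>UNIV. L (axis j 1, 0, B *v axis j 1) $ i $ j)"
proof -
  have lin: "linear L" using L has_derivative_linear by blast
  let ?g = "\<lambda>y. (y, A + (a \<bullet> (y - xo)) *\<^sub>R dyad b a, B *v (y - xo) + c)"
  have g: "(?g has_derivative (\<lambda>h. (h, (a \<bullet> h) *\<^sub>R dyad b a, B *v h))) (at xo)"
    by (auto intro!: derivative_eq_intros has_derivative_affine[where c = 0, simplified])
  have comp: "((\<lambda>y. St y (A + (a \<bullet> (y - xo)) *\<^sub>R dyad b a) (B *v (y - xo) + c)) has_derivative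
      (\<lambda>h. L (h, (a \<bullet> h) *\<^sub>R dyad b a, B *v h))) (at xo)"
    using has_derivative_compose[OF g, of "\<lambda>(x, F, w). St x F w" L] L by simp
  have pdx: "pd (\<lambda>y. St y (A + (a \<bullet> (y - xo)) *\<^sub>R dyad b a) (B *v (y - xo) + c) $ i $ j) (axis j 1) xo
      = a $ j * L (0, dyad b a, 0) $ i $ j + L (axis j 1, 0, B *v axis j 1) $ i $ j" for i j
  proof -
    \<comment> \<open>The direction of differentiation splits into a part carrying \<open>b\<close>,
      with one factor of \<open>a\<close> in front and a second inside \<open>dyad b a\<close>, and
      a part free of \<open>b\<close>.\<close>
    have split: "(axis j 1, (a \<bullet> axis j 1) *\<^sub>R dyad b a, B *v axis j 1) =
        a $ j *\<^sub>R (0, dyad b a, 0) + (axis j 1, 0, B *v axis j 1)"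
      by (simp add: inner_axis)
    show ?thesis
      unfolding pd_eq[OF bounded_linear.has_derivative[OF bounded_linear_vec_nth
          bounded_linear.has_derivative[OF bounded_linear_vec_nth comp]]] split
        linear_add[OF lin] linear_scale[OF lin] by simp
  qed
  have G: "((\<lambda>G. (xo, G, c)) has_derivative (\<lambda>H. (0, H, 0))) (at A)"
    by (auto intro!: derivative_eq_intros)
  have compG: "((\<lambda>G. St xo G c) has_derivative (\<lambda>H. L (0, H, 0))) (at A)"
    using has_derivative_compose[OF G, of "\<lambda>(x, F, w). St x F w" L] L by simp
  have pdF: "pd (\<lambda>G. St xo G c $ i $ j) H A = L (0, H, 0) $ i $ j" for i j H
    by (rule pd_eq[OF bounded_linear.has_derivative[OF bounded_linear_vec_nth
          bounded_linear.has_derivative[OF bounded_linear_vec_nth compG]]])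
  \<comment> \<open>Expansion in basis tensors, so that linearity of \<open>L\<close> produces the
    partial derivatives in the entries of \<open>F\<close>.\<close>
  have dyad: "(0, dyad b a, 0) =
      (\<Sum>h\<in>UNIV. \<Sum>k\<in>UNIV. (b $ h * a $ k) *\<^sub>R (0 :: vect, axis h (axis k 1) :: tensor, 0 :: vect))"
  proof -
    have "dyad b a = (\<Sum>h\<in>UNIV. \<Sum>k\<in>UNIV. (b $ h * a $ k) *\<^sub>R axis h (axis k 1))"
      by (simp add: vec_eq_iff dyad_def forall_3 sum_3 axis_def)
    then show ?thesis
      by (simp add: prod_eq_iff fst_sum snd_sum)
  qed
  have Ldyad: "L (0, dyad b a, 0) $ i $ j =
      (\<Sum>h\<in>UNIV. \<Sum>k\<in>UNIV. (b $ h * a $ k) * L (0, axis h (axis k 1), 0) $ i $ j)" for i j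
    unfolding dyad linear_sum[OF lin] linear_scale[OF lin] by simp
  show ?thesis
    unfolding vec_eq_iff Div_def pdx
    by (simp add: pdF Ldyad matrix_vector_mult_def sum.distrib sum_3 algebra_simps)
qed

section \<open>Time derivatives, one-sided at the initial time\<close>

text \<open>A derivative within a set is unique only at limit points of the set; every point of a
  half-open interval is one, its left endpoint included.\<close>

lemma has_vector_derivative_time_deriv:
  assumes "t \<in> {0..<T}" "(f has_vector_derivative f') (at t within {0..<T})"
  shows "time_deriv T f t = f'"
proof -
  have "at t within {0..<T} \<noteq> bot"
    using assms(1) by (simp add: trivial_limit_within islimpt_Ico)
  then show ?thesis unfolding time_deriv_def by (rule vector_derivative_within[OF _ assms(2)])
qed

text \<open>The joint derivative is restricted to the line of constant \<open>x\<close>.\<close>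

lemma smooth_field_has_derivative_time:
  assumes "smooth_field T f" "t \<in> {0..<T}"
  shows "((f x) has_vector_derivative time_deriv T (f x) t) (at t within {0..<T})"
proof -
  obtain D where D: "((\<lambda>(x, t). f x t) has_derivative D) (at (x, t) within UNIV \<times> {0..<T})"
    using assms unfolding smooth_field_def continuously_differentiable_on_def by blast
  have "((\<lambda>s. (x, s)) has_derivative (\<lambda>h. (0, h))) (at t within {0..<T})"
    by (auto intro!: derivative_eq_intros)
  then have "((\<lambda>s. case (x, s) of (x, t) \<Rightarrow> f x t) has_derivative (\<lambda>h. D (0, h))) (at t within {0..<T})"
    by (rule has_derivative_in_compose[where g = "\<lambda>(x, t). f x t"])
       (rule has_derivative_subset[OF D], auto)
  then show ?thesis
    unfolding time_deriv_def vector_derivative_works[symmetric] differentiable_def by auto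
qed

section \<open>The velocity as the momentum gradient of the energy\<close>

text \<open>Solvability supplies admissible processes that pass through the state
  \<open>(A, p)\<close> at the point \<open>x\<close> and time 0 with arbitrary initial rates. Along
  each, dissipation bounds \<open>D\<close> by the power of stress and velocity; both are linear in
  the rates, so they agree.\<close>

lemma energy_derivative_momentum:
  assumes "T > 0"
    and vh: "continuously_differentiable_on (\<lambda>(x, F, p). vh x F p) UNIV"
    and Sh: "continuously_differentiable_on (\<lambda>(x, F, p). Sh x F p) UNIV"
    and "normality vh"
    and ell: "elliptic (stress_of_velocity vh Sh)"
    and solv: "solvable vh Sh T"
    and dissip: "\<And>F p. admissible_process vh Sh T F p \<Longrightarrow> dissipation_inequality vh Sh \<tau>h T F p"
    and "galilean_velocity vh"
    and D: "((\<lambda>(F, p). \<tau>h x F p) has_derivative D) (at (A, p))"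
  shows "D (0, q) = vh x A p \<bullet> q"
proof -
  \<comment> \<open>Prescribing \<open>c\<close> as initial velocity at \<open>x\<close> makes the
    initial momentum there equal to \<open>p\<close>.\<close>
  define c where "c = vh x A p"
  define St where "St = stress_of_velocity vh Sh"
  \<comment> \<open>One fixed nonzero direction suffices, since its acoustic matrix is already
    invertible.\<close>
  define a :: vect where "a = axis 1 1"
  have "a \<noteq> 0" by (simp add: a_def axis_eq_0_iff)
  have bij: "bij (vh x F)" for x F using \<open>normality vh\<close> by (simp add: normality_def)
  have vh_momentum: "vh y F (momentum_of vh y F w) = w" for y F w
    unfolding momentum_of_def by (meson bij bij_is_surj surj_f_inv_f)
  have pc: "momentum_of vh x A c = p"
    unfolding momentum_of_def c_def by (meson bij bij_is_inj inv_f_f)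
  note mom = momentum_of_continuously_differentiable[OF vh \<open>normality vh\<close> \<open>galilean_velocity vh\<close>]
  have proj: "continuously_differentiable_on (\<lambda>z :: vect \<times> tensor \<times> vect. fst z) UNIV"
    "continuously_differentiable_on (\<lambda>z :: vect \<times> tensor \<times> vect. fst (snd z)) UNIV"
    by (intro continuously_differentiable_on_bounded_linear bounded_linear_intros)+
  have "continuously_differentiable_on (\<lambda>(x, F, w). St x F w) UNIV"
    using continuously_differentiable_on_compose[OF Sh continuously_differentiable_on_Pair[OF proj(1)
        continuously_differentiable_on_Pair[OF proj(2) mom]]]
    by (simp add: St_def stress_of_velocity_def case_prod_unfold)
  then obtain L where L: "((\<lambda>(x, F, w). St x F w) has_derivative L) (at (x, A, c))"
    unfolding continuously_differentiable_on_def by blast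
  define E where "E = acoustic St x A c a"
  have "invertible E"
    using ell \<open>a \<noteq> 0\<close> unfolding elliptic_def E_def St_def by blast
  \<comment> \<open>The share of the stress divergence due to the explicit dependence on the point
    and to the velocity gradient. It does not involve \<open>b\<close>.\<close>
  define w where "w B = (\<chi> i. \<Sum>j\<in>UNIV. L (axis j 1, 0, B *v axis j 1) $ i $ j)" for B :: tensor
  have ineq: "D (B, E *v b + w B) \<le> Sh x A p \<bullet> B + c \<bullet> (E *v b + w B)" for B b
  proof -
    obtain F v where F: "smooth_field T F" and v: "smooth_field T v"
      and eqF: "\<And>x t. t \<in> {0..<T} \<Longrightarrow> time_deriv T (F x) t = Grad (\<lambda>y. v y t) x"
      and eqp: "\<And>x t. t \<in> {0..<T} \<Longrightarrow> time_deriv T (\<lambda>s. momentum_of vh x (F x s) (v x s)) t =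
                Div (\<lambda>y. St y (F y t) (v y t)) x"
      and F0: "\<And>y. F y 0 = A + (a \<bullet> (y - x)) *\<^sub>R dyad b a"
      and v0: "\<And>y. v y 0 = B *v (y - x) + c"
      using solv[unfolded solvable_def, rule_format, OF \<open>a \<noteq> 0\<close>, of A x b B c]
      unfolding St_def by blast
    \<comment> \<open>The solution is given in terms of velocity, whereas admissibility is stated
      for momentum; \<open>P\<close> translates, and smoothness of \<open>momentum_of\<close>
      carries over to it.\<close>
    define P where "P x s = momentum_of vh x (F x s) (v x s)" for x s
    have "continuously_differentiable_on (\<lambda>z :: vect \<times> real. fst z) (UNIV \<times> {0..<T})"
      by (intro continuously_differentiable_on_bounded_linear bounded_linear_intros)
    then have P: "smooth_field T P"
      using continuously_differentiable_on_compose[OF mom continuously_differentiable_on_Pair[OF _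
          continuously_differentiable_on_Pair[OF F[unfolded smooth_field_def] v[unfolded smooth_field_def]]]]
      by (simp add: smooth_field_def P_def case_prod_unfold)
    have "admissible_process vh Sh T F P"
      unfolding admissible_process_def
      using F P eqF eqp by (simp add: P_def[abs_def] vh_momentum St_def stress_of_velocity_def)
    then have "dissipation_inequality vh Sh \<tau>h T F P" by (rule dissip)
    moreover have t0: "0 \<in> {0..<T}" using \<open>T > 0\<close> by simp
    ultimately have le: "time_deriv T (\<lambda>s. \<tau>h x (F x s) (P x s)) 0
          \<le> Sh x (F x 0) (P x 0) \<bullet> time_deriv T (F x) 0 + vh x (F x 0) (P x 0) \<bullet> time_deriv T (P x) 0"
      unfolding dissipation_inequality_def by blast
    have Fx0: "F x 0 = A" and Px0: "P x 0 = p" using F0[of x] v0[of x] pc by (simp_all add: P_def)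
    have "Grad (\<lambda>y. v y 0) x = B"
      unfolding Grad_def v0 by (simp add: matrix_eq jacobian_mult_vec[OF has_derivative_affine])
    then have dF: "time_deriv T (F x) 0 = B" using eqF[OF t0] by simp
    have dP: "time_deriv T (P x) 0 = E *v b + w B"
      using eqp[OF t0, of x] Div_initial_stress[OF L, of a b B]
      unfolding F0 v0 E_def w_def P_def[abs_def] by simp
    have FP: "((\<lambda>s. (F x s, P x s)) has_vector_derivative (B, E *v b + w B)) (at 0 within {0..<T})"
      using has_vector_derivative_Pair[OF smooth_field_has_derivative_time[OF F t0, of x]
        smooth_field_has_derivative_time[OF P t0, of x]] unfolding dF dP .
    \<comment> \<open>Chain rule along the curve of states at the fixed point \<open>x\<close>; only
      the derivative of the energy in \<open>(F, p)\<close> enters.\<close>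
    have "((\<lambda>s. \<tau>h x (F x s) (P x s)) has_derivative (\<lambda>h. D (h *\<^sub>R (B, E *v b + w B)))) (at 0 within {0..<T})"
      using has_derivative_compose[OF FP[unfolded has_vector_derivative_def], of "\<lambda>(F, p). \<tau>h x F p" D] D
      by (simp add: Fx0 Px0)
    then have "((\<lambda>s. \<tau>h x (F x s) (P x s)) has_vector_derivative D (B, E *v b + w B)) (at 0 within {0..<T})"
      unfolding has_vector_derivative_def
      by (simp add: linear_scale[OF has_derivative_linear[OF D]] del: scaleR_Pair)
    then show ?thesis
      using le by (simp add: has_vector_derivative_time_deriv[OF t0] Fx0 Px0 dF dP c_def)
  qed
  \<comment> \<open>Any momentum rate \<open>r\<close> is attained together with \<open>B\<close>:
    solve \<open>E *v b = r - w B\<close> for \<open>b\<close>.\<close>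
  have "D (B, r) \<le> Sh x A p \<bullet> B + c \<bullet> r" for B r
  proof -
    obtain E' where "E ** E' = mat 1" using \<open>invertible E\<close> unfolding invertible_def by blast
    then have "E *v (E' *v (r - w B)) = r - w B" by (simp add: matrix_vector_mul_assoc)
    then show ?thesis using ineq[of B "E' *v (r - w B)"] by simp
  qed
  \<comment> \<open>Ordered linear forms coincide; the claim is the case of rates
    \<open>(0, q)\<close>.\<close>
  then have "D z = (\<lambda>(B, r). Sh x A p \<bullet> B + c \<bullet> r) z" for z
    by (intro linear_le_imp_eq has_derivative_linear[OF D])
       (auto simp: linear_iff inner_add_right algebra_simps)
  then show ?thesis by (simp add: c_def)
qed

section \<open>Potentials of linear gradient fields\<close>

text \<open>Integration along rays gives the quadratic form. Differentiating that form returns the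
  symmetric part of \<open>V\<close>, which must therefore be \<open>V\<close> itself.\<close>

lemma quadratic_potential:
  fixes f :: "real^'n \<Rightarrow> real"
  assumes "\<And>p. (f has_derivative (\<lambda>h. (V *v p) \<bullet> h)) (at p)"
  shows "f p = f 0 + 1/2 * (p \<bullet> (V *v p))"
    and "transpose V = V"
proof -
  show rep: "f p = f 0 + 1/2 * (p \<bullet> (V *v p))" for p
  proof -
    \<comment> \<open>Both terms have derivative \<open>s * (p \<bullet> (V *v p))\<close> in
      \<open>s\<close>; the constant difference is then compared at \<open>s = 1\<close> and
      \<open>s = 0\<close>.\<close>
    have "((\<lambda>s. f (s *\<^sub>R p) - s^2 * (1/2 * (p \<bullet> (V *v p)))) has_derivative (\<lambda>_. 0)) (at s within UNIV)" for s
    proof -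
      have "((\<lambda>s. f (s *\<^sub>R p)) has_derivative (\<lambda>h. (V *v (s *\<^sub>R p)) \<bullet> (h *\<^sub>R p))) (at s)"
        by (rule has_derivative_compose[OF _ assms]) (auto intro!: derivative_eq_intros)
      then show ?thesis
        by (auto intro!: derivative_eq_intros simp: fun_eq_iff matrix_vector_mult_scaleR inner_commute)
    qed
    then obtain k where "\<And>s. f (s *\<^sub>R p) - s^2 * (1/2 * (p \<bullet> (V *v p))) = k"
      using has_derivative_zero_constant[OF convex_UNIV, of "\<lambda>s. f (s *\<^sub>R p) - s^2 * (1/2 * (p \<bullet> (V *v p)))"]
      by blast
    from this[of 1] this[of 0] show ?thesis by simp
  qed
  have half: "(V *v p) \<bullet> h = 1/2 * (p \<bullet> (V *v h) + h \<bullet> (V *v p))" for p h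
  proof -
    have V: "((*v) V has_derivative (*v) V) (at p)"
      by (rule bounded_linear_imp_has_derivative[OF matrix_vector_mul_bounded_linear])
    have "((\<lambda>p. f 0 + 1/2 * (p \<bullet> (V *v p))) has_derivative
        (\<lambda>h. 1/2 * (p \<bullet> (V *v h) + h \<bullet> (V *v p)))) (at p)"
      by (auto intro!: derivative_eq_intros V)
    moreover have "(\<lambda>p. f 0 + 1/2 * (p \<bullet> (V *v p))) = f"
      by (rule ext) (rule rep[symmetric])
    ultimately have "(f has_derivative (\<lambda>h. 1/2 * (p \<bullet> (V *v h) + h \<bullet> (V *v p)))) (at p)"
      by (simp only:)
    from fun_cong[OF has_derivative_unique[OF assms this]] show ?thesis .
  qed
  have "(transpose V *v p) \<bullet> h = (V *v p) \<bullet> h" for p h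
    using half[of p h] inner_commute[of h "V *v p"] by (simp add: transpose_matrix_vector dot_lmul_matrix)
  then have "transpose V *v p = V *v p" for p
    using vector_eq_rdot[of "transpose V *v p" "V *v p"] by blast
  then show "transpose V = V" by (simp add: matrix_eq)
qed

section \<open>Kinetic and stored energy\<close>

theorem proposition4:
  fixes vh :: "vect \<Rightarrow> tensor \<Rightarrow> vect \<Rightarrow> vect"
    and Sh :: "vect \<Rightarrow> tensor \<Rightarrow> vect \<Rightarrow> tensor"
    and \<tau>h :: "vect \<Rightarrow> tensor \<Rightarrow> vect \<Rightarrow> real"
    and T :: real
  assumes "T > 0"
    and "continuously_differentiable_on (\<lambda>(x, F, p). vh x F p) UNIV"
    and "continuously_differentiable_on (\<lambda>(x, F, p). Sh x F p) UNIV"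
    and "\<And>x. continuously_differentiable_on (\<lambda>(F, p). \<tau>h x F p) UNIV"
    and "normality vh"
    and "elliptic (stress_of_velocity vh Sh)"
    and "solvable vh Sh T"
    and "\<And>F p. admissible_process vh Sh T F p \<Longrightarrow> dissipation_inequality vh Sh \<tau>h T F p"
    and "galilean_velocity vh"
    and "even_in_momentum \<tau>h"
  shows "\<exists>(V :: vect \<Rightarrow> tensor) (\<kappa> :: vect \<Rightarrow> vect \<Rightarrow> real) (\<sigma> :: vect \<Rightarrow> tensor \<Rightarrow> real).
           \<forall>x. transpose (V x) = V x \<and> invertible (V x) \<and>
               (\<forall>F p. vh x F p = V x *v p) \<and>
               (\<forall>F p. \<tau>h x F p = \<kappa> x p + \<sigma> x F) \<and>
               (\<forall>p. \<kappa> x p = 1/2 * (p \<bullet> (V x *v p)))"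
proof -
  define V where "V x = jacobian (vh x 0) (at 0)" for x
  have gradient: "(\<tau>h x F has_derivative (\<lambda>h. vh x F p \<bullet> h)) (at p)" for x F p
  proof -
    obtain D where D: "((\<lambda>(F, p). \<tau>h x F p) has_derivative D) (at (F, p))"
      using assms(4)[of x] unfolding continuously_differentiable_on_def by blast
    have "((\<lambda>p. (F, p)) has_derivative (\<lambda>h. (0, h))) (at p)"
      by (auto intro!: derivative_eq_intros)
    from has_derivative_compose[OF this D]
    show ?thesis
      using energy_derivative_momentum[OF assms(1-3,5-9) D] by simp
  qed
  \<comment> \<open>An even function has zero gradient at the origin: differentiating the parity
    identity there equates the gradient with its negative.\<close>
  have rest: "vh x F 0 = 0" for x F
  proof -
    have "((\<lambda>p. \<tau>h x F (- p)) has_derivative (\<lambda>h. vh x F 0 \<bullet> (- h))) (at 0)"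
      by (rule has_derivative_compose[where g = "\<tau>h x F" and f = uminus and f' = uminus])
         (use gradient[of x F 0] in \<open>auto intro!: derivative_eq_intros\<close>)
    moreover have "(\<lambda>p. \<tau>h x F (- p)) = \<tau>h x F"
      using assms(10) by (simp add: even_in_momentum_def fun_eq_iff)
    ultimately have "(\<lambda>h. vh x F 0 \<bullet> (- h)) = (\<lambda>h. vh x F 0 \<bullet> h)"
      using gradient has_derivative_unique by metis
    then have "vh x F 0 \<bullet> (- vh x F 0) = vh x F 0 \<bullet> vh x F 0" by metis
    then show ?thesis by simp
  qed
  have linear: "vh x F p = V x *v p" for x F p
    using galilean_velocity_affine[OF assms(9,2), of x F p] by (simp add: rest V_def)
  have "invertible (V x)" for x
    using assms(5) unfolding normality_def V_def by blast
  moreover have potential: "(\<tau>h x F has_derivative (\<lambda>h. (V x *v p) \<bullet> h)) (at p)" for x F p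
    using gradient[of x F p] unfolding linear .
  moreover have "transpose (V x) = V x" for x
    by (rule quadratic_potential(2)[OF potential[of x 0]])
  moreover have "\<tau>h x F p = 1/2 * (p \<bullet> (V x *v p)) + \<tau>h x F 0" for x F p
    using quadratic_potential(1)[OF potential, of x F p] by simp
  ultimately show ?thesis
    using linear
    \<comment> \<open>The stored energy is the total energy at zero momentum, which is the constant
      of integration along the rays.\<close>
    by (intro exI[of _ V] exI[of _ "\<lambda>x p. 1/2 * (p \<bullet> (V x *v p))"] exI[of _ "\<lambda>x F. \<tau>h x F 0"]) blast
qed

end
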